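(* Every $\Gamma$-unique dcpo belongs to $\mathcal R_2$.
   Context: Directed subsets are nonempty; a dcpo is a poset in which every directed subset has a supremum. $\mathbf{DCPO}$ is the category of dcpos and Scott-continuous maps. For dcpos $A,B$, $[A\to B]$ is the dcpo of Scott-continuous maps ordered pointwise. All full subcategories are closed under isomorphisms. $\Gamma(P)$ is the complete lattice of Scott-closed subsets of $P$ ordered by inclusion. A dcpo $P$ is $\Gamma$-unique if for every dcpo $Q$, $\Gamma(P)\cong\Gamma(Q)$ (order isomorphism) implies $P\cong Q$. Let $2=\{0<1\}$. $E_2$ is the class of all Scott-continuous maps $e:A\to B$ between dcpos such that $e^*:[B\to 2]\to[A\to 2]$, $g\mapsto g\circ e$, is an isomorphism of dcpos (equivalently, $e^{-1}$ is an order isomorphism from the lattice of Scott-open sets of $B$ onto that of $A$). $\mathcal R_2=E_2^{\perp}$ is the full subcategory of $\mathbf{DCPO}$ of all dcpos $C$ such that for every $e:A\to B$ in $E_2$ the map $e^*:[B\to C]\to[A\to C]$, $g\mapsto g\circ e$, is an isomorphism of dcpos. (It is the least reflective full subcategory of $\mathbf{DCPO}$ containing $2$.) *)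

theory Defs
  imports "HOL-Algebra.Order" "HOL-Library.FuncSet"
begin

text \<open>
  Posets are carrier-based (\<open>gorder\<close> records satisfying \<open>partial_order\<close>), because
  \<open>\<Gamma>\<close>-uniqueness quantifies over dcpos inside the statement. Carriers may be empty.
\<close>

definition directed_in :: "('a, 'm) gorder_scheme \<Rightarrow> 'a set \<Rightarrow> bool"
  where "directed_in L D \<longleftrightarrow>
    D \<subseteq> carrier L \<and> D \<noteq> {} \<and> (\<forall>x\<in>D. \<forall>y\<in>D. \<exists>z\<in>D. x \<sqsubseteq>\<^bsub>L\<^esub> z \<and> y \<sqsubseteq>\<^bsub>L\<^esub> z)"

locale dcpo = partial_order L for L (structure) +
  assumes directed_has_lub: "directed_in L D \<Longrightarrow> \<exists>s. is_lub L s D"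

text \<open>Monotonicity follows, since \<open>{x, y}\<close> is directed with supremum \<open>y\<close> whenever \<open>x \<sqsubseteq> y\<close>.\<close>

definition scott_continuous :: "('a, 'm) gorder_scheme \<Rightarrow> ('b, 'n) gorder_scheme \<Rightarrow> ('a \<Rightarrow> 'b) \<Rightarrow> bool"
  where "scott_continuous A B f \<longleftrightarrow>
    f \<in> carrier A \<rightarrow> carrier B \<and>
    (\<forall>D s. directed_in A D \<and> is_lub A s D \<longrightarrow> is_lub B (f s) (f ` D))"

text \<open>Isomorphisms in the category of dcpos and Scott-continuous maps.\<close>

definition dcpo_iso :: "('a, 'm) gorder_scheme \<Rightarrow> ('b, 'n) gorder_scheme \<Rightarrow> ('a \<Rightarrow> 'b) \<Rightarrow> bool"
  where "dcpo_iso A B f \<longleftrightarrow>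
    scott_continuous A B f \<and>
    (\<exists>g. scott_continuous B A g \<and>
         (\<forall>x\<in>carrier A. g (f x) = x) \<and> (\<forall>y\<in>carrier B. f (g y) = y))"

definition order_iso :: "('a, 'm) gorder_scheme \<Rightarrow> ('b, 'n) gorder_scheme \<Rightarrow> ('a \<Rightarrow> 'b) \<Rightarrow> bool"
  where "order_iso A B f \<longleftrightarrow> order_emb A B f \<and> bij_betw f (carrier A) (carrier B)"

text \<open>
  The function space \<open>[A \<rightarrow> B]\<close>. Its elements are \<open>undefined\<close> off \<open>carrier A\<close>, so that maps
  agreeing on \<open>carrier A\<close> are equal.
\<close>

definition fun_space :: "('a, 'm) gorder_scheme \<Rightarrow> ('b, 'n) gorder_scheme \<Rightarrow> ('a \<Rightarrow> 'b) gorder"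
  where "fun_space A B =
    \<lparr>carrier = {f \<in> carrier A \<rightarrow>\<^sub>E carrier B. scott_continuous A B f},
     eq = (=),
     le = (\<lambda>f g. \<forall>x\<in>carrier A. f x \<sqsubseteq>\<^bsub>B\<^esub> g x)\<rparr>"

text \<open>The map \<open>e\<^sup>* : [B \<rightarrow> C] \<rightarrow> [A \<rightarrow> C]\<close>; only \<open>carrier A\<close> enters its formula.\<close>

definition precomp :: "('a, 'm) gorder_scheme \<Rightarrow> ('a \<Rightarrow> 'b) \<Rightarrow> ('b \<Rightarrow> 'c) \<Rightarrow> ('a \<Rightarrow> 'c)"
  where "precomp A e = (\<lambda>g. compose (carrier A) g e)"

text \<open>The two-element chain \<open>False < True\<close>.\<close>

definition two :: "bool gorder"
  where "two = \<lparr>carrier = UNIV, eq = (=), le = (\<le>)\<rparr>"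

definition in_E2 :: "('a, 'm) gorder_scheme \<Rightarrow> ('b, 'n) gorder_scheme \<Rightarrow> ('a \<Rightarrow> 'b) \<Rightarrow> bool"
  where "in_E2 A B e \<longleftrightarrow>
    dcpo A \<and> dcpo B \<and> scott_continuous A B e \<and>
    dcpo_iso (fun_space B two) (fun_space A two) (precomp A e)"

text \<open>
  HOL cannot quantify over types inside a formula, so membership in \<open>E\<^sub>2\<^sup>\<bottom>\<close> takes the ambient types
  of the test maps \<open>e : A \<rightarrow> B\<close> as arguments. A theorem concluding \<open>in_R2 TYPE('a) TYPE('b) C\<close> with
  \<open>'a\<close>, \<open>'b\<close> free type variables covers all dcpos \<open>A\<close>, \<open>B\<close>.
\<close>

definition in_R2 :: "'a itself \<Rightarrow> 'b itself \<Rightarrow> 'c gorder \<Rightarrow> bool"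
  where "in_R2 TA TB C \<longleftrightarrow>
    dcpo C \<and>
    (\<forall>(A :: 'a gorder) (B :: 'b gorder) e.
       in_E2 A B e \<longrightarrow> dcpo_iso (fun_space B C) (fun_space A C) (precomp A e))"

definition scott_closed :: "('a, 'm) gorder_scheme \<Rightarrow> 'a set \<Rightarrow> bool"
  where "scott_closed P F \<longleftrightarrow>
    F \<subseteq> carrier P \<and>
    (\<forall>x\<in>carrier P. \<forall>y\<in>F. x \<sqsubseteq>\<^bsub>P\<^esub> y \<longrightarrow> x \<in> F) \<and>
    (\<forall>D s. directed_in P D \<and> D \<subseteq> F \<and> is_lub P s D \<longrightarrow> s \<in> F)"

definition Gamma :: "('a, 'm) gorder_scheme \<Rightarrow> 'a set gorder"
  where "Gamma P = \<lparr>carrier = {F. scott_closed P F}, eq = (=), le = (\<subseteq>)\<rparr>"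

text \<open>
  \<open>Q\<close> ranges over dcpos carried by subsets of the type \<open>'a set\<close>. This is no restriction: any \<open>Q\<close>
  embeds into \<open>Gamma Q\<close> by \<open>q \<mapsto> \<down>q\<close>, hence into \<open>'a set\<close> if \<open>Gamma P \<cong> Gamma Q\<close>. See
  \<open>gamma_uniqueD\<close> below for the statement with \<open>Q\<close> over an arbitrary type.
\<close>

definition gamma_unique :: "'a gorder \<Rightarrow> bool"
  where "gamma_unique P \<longleftrightarrow>
    dcpo P \<and>
    (\<forall>Q :: 'a set gorder.
       dcpo Q \<longrightarrow> (\<exists>h. order_iso (Gamma P) (Gamma Q) h) \<longrightarrow> (\<exists>f. dcpo_iso P Q f))"


subsection \<open>Order isomorphisms\<close>

lemma order_iso_inv:
  assumes "order_iso L M f"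
  shows "order_iso M L (inv_into (carrier L) f)"
proof -
  have b: "bij_betw f (carrier L) (carrier M)" using assms by (simp add: order_iso_def)
  let ?g = "inv_into (carrier L) f"
  have bg: "bij_betw ?g (carrier M) (carrier L)" using b by (rule bij_betw_inv_into)
  have "?g x \<sqsubseteq>\<^bsub>L\<^esub> ?g y \<longleftrightarrow> x \<sqsubseteq>\<^bsub>M\<^esub> y" if "x \<in> carrier M" "y \<in> carrier M" for x y
  proof -
    have "?g x \<in> carrier L" "?g y \<in> carrier L" using bg that by (auto dest: bij_betwE)
    moreover have "f (?g x) = x" "f (?g y) = y" using b that by (auto simp: bij_betw_inv_into_right)
    ultimately show ?thesis using assms unfolding order_iso_def order_emb_def by metis
  qed
  then show ?thesis using assms bg by (simp add: order_iso_def order_emb_def)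
qed

lemma order_iso_trans:
  assumes "order_iso L M f" "order_iso M N g"
  shows "order_iso L N (g \<circ> f)"
proof -
  have "f x \<in> carrier M" if "x \<in> carrier L" for x
    using assms(1) that by (auto simp: order_iso_def dest: bij_betwE)
  then show ?thesis
    using assms by (auto simp: order_iso_def order_emb_def intro: bij_betw_trans)
qed

lemma order_iso_lub:
  assumes "order_iso L M f" "D \<subseteq> carrier L" "is_lub L s D"
  shows "is_lub M (f s) (f ` D)"
proof -
  have b: "bij_betw f (carrier L) (carrier M)"
    and le: "\<And>x y. x \<in> carrier L \<Longrightarrow> y \<in> carrier L \<Longrightarrow> f x \<sqsubseteq>\<^bsub>M\<^esub> f y \<longleftrightarrow> x \<sqsubseteq>\<^bsub>L\<^esub> y"
    using assms(1) by (auto simp: order_iso_def order_emb_def)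
  have s: "s \<in> carrier L" using assms(3) by blast
  have fc: "f x \<in> carrier M" if "x \<in> carrier L" for x using b that by (auto dest: bij_betwE)
  have "f s \<sqsubseteq>\<^bsub>M\<^esub> u" if "u \<in> Upper M (f ` D)" for u
  proof -
    have uc: "u \<in> carrier M" using that by (simp add: Upper_def)
    then obtain v where v: "v \<in> carrier L" "u = f v" using b by (auto simp: bij_betw_def)
    have "v \<in> Upper L D"
      using that v fc le assms(2) by (auto simp: Upper_def)
    then have "s \<sqsubseteq>\<^bsub>L\<^esub> v" using assms(3) by (auto simp: least_def)
    then show ?thesis using le s v by simp
  qed
  moreover have "f s \<in> Upper M (f ` D)"
    using assms(2,3) le s fc by (auto simp: Upper_def least_def)
  ultimately show ?thesis by (simp add: least_def)
qed

lemma order_iso_directed: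
  assumes "order_iso L M f" "directed_in L D"
  shows "directed_in M (f ` D)"
proof -
  have DL: "D \<subseteq> carrier L" and ne: "D \<noteq> {}"
    and dir: "\<And>x y. x \<in> D \<Longrightarrow> y \<in> D \<Longrightarrow> \<exists>z\<in>D. x \<sqsubseteq>\<^bsub>L\<^esub> z \<and> y \<sqsubseteq>\<^bsub>L\<^esub> z"
    using assms(2) by (simp_all add: directed_in_def)
  have le: "f x \<sqsubseteq>\<^bsub>M\<^esub> f y" if "x \<in> D" "y \<in> D" "x \<sqsubseteq>\<^bsub>L\<^esub> y" for x y
    using assms(1) DL that by (simp add: order_iso_def order_emb_def subset_iff)
  have "f ` carrier L = carrier M" using assms(1) by (simp add: order_iso_def bij_betw_def)
  then have "f ` D \<subseteq> carrier M" using image_mono[OF DL, of f] by simp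
  moreover have "\<exists>z\<in>D. f x \<sqsubseteq>\<^bsub>M\<^esub> f z \<and> f y \<sqsubseteq>\<^bsub>M\<^esub> f z" if "x \<in> D" "y \<in> D" for x y
    using dir[OF that] le that by meson
  ultimately show ?thesis using ne by (simp add: directed_in_def)
qed

lemma order_iso_scott_continuous:
  assumes "order_iso L M f"
  shows "scott_continuous L M f"
  unfolding scott_continuous_def
  using order_iso_lub[OF assms] assms
  by (auto simp: directed_in_def order_iso_def dest: bij_betwE)

lemma order_iso_imp_dcpo_iso:
  assumes "order_iso L M f"
  shows "dcpo_iso L M f"
proof -
  have "bij_betw f (carrier L) (carrier M)" using assms by (simp add: order_iso_def)
  then show ?thesis
    unfolding dcpo_iso_def
    using order_iso_scott_continuous[OF assms] order_iso_scott_continuous[OF order_iso_inv[OF assms]]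
    by (auto intro!: exI[of _ "inv_into (carrier L) f"]
        simp: bij_betw_inv_into_left bij_betw_inv_into_right)
qed

lemma scott_continuous_mono:
  assumes "dcpo A" "partial_order B" "scott_continuous A B f"
    "x \<in> carrier A" "y \<in> carrier A" "x \<sqsubseteq>\<^bsub>A\<^esub> y"
  shows "f x \<sqsubseteq>\<^bsub>B\<^esub> f y"
proof -
  interpret dcpo A by fact
  have "directed_in A {x, y}" using assms by (auto simp: directed_in_def)
  moreover have "is_lub A y {x, y}" using assms by (auto simp: least_def Upper_def)
  ultimately have "is_lub B (f y) (f ` {x, y})"
    using assms(3) unfolding scott_continuous_def by blast
  moreover have "f x \<in> carrier B" using assms by (auto simp: scott_continuous_def)
  ultimately show ?thesis by (auto simp: least_def Upper_def)
qed

lemma dcpo_iso_iff_order_iso: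
  assumes "dcpo A" "dcpo B"
  shows "dcpo_iso A B f \<longleftrightarrow> order_iso A B f"
proof
  interpret A: dcpo A by fact
  interpret B: dcpo B by fact
  assume "dcpo_iso A B f"
  then obtain g where f: "scott_continuous A B f" and g: "scott_continuous B A g"
    and gf: "\<And>x. x \<in> carrier A \<Longrightarrow> g (f x) = x" and fg: "\<And>y. y \<in> carrier B \<Longrightarrow> f (g y) = y"
    by (auto simp: dcpo_iso_def)
  have fc: "f x \<in> carrier B" if "x \<in> carrier A" for x using f that by (auto simp: scott_continuous_def)
  have gc: "g x \<in> carrier A" if "x \<in> carrier B" for x using g that by (auto simp: scott_continuous_def)
  have "f x \<sqsubseteq>\<^bsub>B\<^esub> f y \<longleftrightarrow> x \<sqsubseteq>\<^bsub>A\<^esub> y" if "x \<in> carrier A" "y \<in> carrier A" for x y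
    using scott_continuous_mono[OF assms(1) B.partial_order_axioms f that]
      scott_continuous_mono[OF assms(2) A.partial_order_axioms g, of "f x" "f y"]
      gf fc that by auto
  moreover have "bij_betw f (carrier A) (carrier B)"
    by (rule bij_betw_byWitness[where f' = g]) (use fc gc gf fg in auto)
  ultimately show "order_iso A B f"
    by (simp add: order_iso_def order_emb_def A.weak_partial_order_axioms B.weak_partial_order_axioms)
qed (rule order_iso_imp_dcpo_iso)


subsection \<open>The choice of type in the definition of uniqueness is immaterial\<close>

lemma partial_order_inclusion:
  "partial_order \<lparr>carrier = X, eq = (=), le = (\<subseteq>)\<rparr>"
  by unfold_locales auto

lemma partial_order_Gamma: "partial_order (Gamma P)"
  unfolding Gamma_def by (rule partial_order_inclusion)

lemma order_iso_dcpo: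
  assumes "order_iso L M f" "dcpo L" "partial_order M"
  shows "dcpo M"
proof -
  interpret L: dcpo L by fact
  interpret M: partial_order M by fact
  show ?thesis
  proof
    fix D assume D: "directed_in M D"
    let ?g = "inv_into (carrier L) f"
    have b: "bij_betw f (carrier L) (carrier M)" using assms(1) by (simp add: order_iso_def)
    have g: "directed_in L (?g ` D)" using order_iso_directed[OF order_iso_inv[OF assms(1)] D] .
    then obtain s where "is_lub L s (?g ` D)" using L.directed_has_lub by blast
    then have "is_lub M (f s) (f ` ?g ` D)"
      using order_iso_lub[OF assms(1)] g by (simp add: directed_in_def)
    moreover have "f ` ?g ` D = D"
      using b D by (simp add: directed_in_def bij_betw_def image_inv_into_cancel)
    ultimately show "\<exists>s. is_lub M s D" by auto
  qed
qed

lemma order_iso_scott_closed: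
  assumes iso: "order_iso L M f" and F: "scott_closed L F"
  shows "scott_closed M (f ` F)"
proof -
  let ?g = "inv_into (carrier L) f"
  have b: "bij_betw f (carrier L) (carrier M)"
    and le: "\<And>x y. x \<in> carrier L \<Longrightarrow> y \<in> carrier L \<Longrightarrow> f x \<sqsubseteq>\<^bsub>M\<^esub> f y \<longleftrightarrow> x \<sqsubseteq>\<^bsub>L\<^esub> y"
    using iso by (auto simp: order_iso_def order_emb_def)
  have FL: "F \<subseteq> carrier L" using F by (simp add: scott_closed_def)
  have inv: "?g (f x) = x" if "x \<in> carrier L" for x using b that by (rule bij_betw_inv_into_left)
  have inv': "f (?g y) = y" if "y \<in> carrier M" for y using b that by (rule bij_betw_inv_into_right)
  have "x \<in> f ` F" if x: "x \<in> carrier M" "x \<sqsubseteq>\<^bsub>M\<^esub> f y" "y \<in> F" for x y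
  proof -
    obtain v where "v \<in> carrier L" "x = f v" using b x by (auto simp: bij_betw_def)
    then show ?thesis using x le FL F unfolding scott_closed_def by blast
  qed
  moreover have "s \<in> f ` F" if D: "directed_in M D" "D \<subseteq> f ` F" "is_lub M s D" for D s
  proof -
    have "directed_in L (?g ` D)" using order_iso_directed[OF order_iso_inv[OF iso] D(1)] .
    moreover have "is_lub L (?g s) (?g ` D)"
      using order_iso_lub[OF order_iso_inv[OF iso] _ D(3)] D(1) by (simp add: directed_in_def)
    moreover have "?g ` D \<subseteq> F" using D(2) FL inv by force
    ultimately have "?g s \<in> F" using F unfolding scott_closed_def by blast
    moreover have "s \<in> carrier M" using D(3) by blast
    ultimately show ?thesis using inv' by force
  qed
  moreover have "f ` F \<subseteq> carrier M" using FL b by (auto simp: bij_betw_def)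
  ultimately show ?thesis unfolding scott_closed_def by blast
qed

lemma order_iso_Gamma:
  assumes iso: "order_iso L M f"
  shows "order_iso (Gamma L) (Gamma M) ((`) f)"
proof -
  let ?g = "inv_into (carrier L) f"
  have b: "bij_betw f (carrier L) (carrier M)" using iso by (simp add: order_iso_def)
  have gf: "?g ` f ` F = F" if "F \<subseteq> carrier L" for F
    using b that by (metis bij_betw_def inv_into_image_cancel)
  have fg: "f ` ?g ` F = F" if "F \<subseteq> carrier M" for F
    using b that by (metis bij_betw_def image_inv_into_cancel)
  have "bij_betw ((`) f) {F. scott_closed L F} {F. scott_closed M F}"
  proof (rule bij_betw_byWitness[where f' = "(`) ?g"])
    show "\<forall>F\<in>{F. scott_closed L F}. ?g ` f ` F = F" using gf by (auto simp: scott_closed_def)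
    show "\<forall>F\<in>{F. scott_closed M F}. f ` ?g ` F = F" using fg by (auto simp: scott_closed_def)
  qed (auto intro: order_iso_scott_closed[OF iso] order_iso_scott_closed[OF order_iso_inv[OF iso]])
  moreover have "f ` F \<subseteq> f ` G \<longleftrightarrow> F \<subseteq> G" if "scott_closed L F" "scott_closed L G" for F G
    using gf that by (metis image_mono scott_closed_def)
  ultimately show ?thesis
    using partial_order_Gamma[of L] partial_order_Gamma[of M]
    by (auto simp: order_iso_def order_emb_def partial_order_def Gamma_def)
qed

lemma scott_closed_down:
  assumes "dcpo Q" "q \<in> carrier Q"
  shows "scott_closed Q {x \<in> carrier Q. x \<sqsubseteq>\<^bsub>Q\<^esub> q}"
proof -
  interpret dcpo Q by fact
  show ?thesis
    unfolding scott_closed_def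
  proof (intro conjI ballI allI impI)
    fix x y assume "x \<in> carrier Q" "y \<in> {x \<in> carrier Q. x \<sqsubseteq>\<^bsub>Q\<^esub> q}" "x \<sqsubseteq>\<^bsub>Q\<^esub> y"
    then show "x \<in> {x \<in> carrier Q. x \<sqsubseteq>\<^bsub>Q\<^esub> q}" using assms(2) le_trans by blast
  next
    fix D s assume "directed_in Q D \<and> D \<subseteq> {x \<in> carrier Q. x \<sqsubseteq>\<^bsub>Q\<^esub> q} \<and> is_lub Q s D"
    moreover from this have "q \<in> Upper Q D" using assms(2) by (auto simp: Upper_def)
    ultimately show "s \<in> {x \<in> carrier Q. x \<sqsubseteq>\<^bsub>Q\<^esub> q}"
      by (auto simp: least_le)
  qed auto
qed

theorem gamma_uniqueD:
  fixes P :: "'a gorder" and Q :: "'b gorder"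
  assumes "gamma_unique P" "dcpo Q" and h: "order_iso (Gamma P) (Gamma Q) h"
  shows "\<exists>f. dcpo_iso P Q f"
proof -
  interpret Q: dcpo Q by fact
  define down where "down q = {x \<in> carrier Q. x \<sqsubseteq>\<^bsub>Q\<^esub> q}" for q
  define k where "k = inv_into (carrier (Gamma P)) h"
  define j where "j = k \<circ> down"
  define R :: "'a set gorder" where "R = \<lparr>carrier = j ` carrier Q, eq = (=), le = (\<subseteq>)\<rparr>"
  have k: "order_iso (Gamma Q) (Gamma P) k" unfolding k_def by (rule order_iso_inv[OF h])
  have dc: "down q \<in> carrier (Gamma Q)" if "q \<in> carrier Q" for q
    using scott_closed_down[OF assms(2) that] by (simp add: Gamma_def down_def)
  have dle: "down p \<subseteq> down q \<longleftrightarrow> p \<sqsubseteq>\<^bsub>Q\<^esub> q" if "p \<in> carrier Q" "q \<in> carrier Q" for p q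
    using that Q.le_trans by (auto simp: down_def)
  have jle: "j p \<subseteq> j q \<longleftrightarrow> p \<sqsubseteq>\<^bsub>Q\<^esub> q" if "p \<in> carrier Q" "q \<in> carrier Q" for p q
    using k dc[OF that(1)] dc[OF that(2)] dle[OF that]
    by (simp add: order_iso_def order_emb_def j_def) (simp add: Gamma_def)
  have "inj_on j (carrier Q)"
    by (rule inj_onI) (metis Q.le_antisym jle order_refl)
  moreover have R: "partial_order R" unfolding R_def by (rule partial_order_inclusion)
  ultimately have QR: "order_iso Q R j"
    using jle Q.weak_partial_order_axioms
    by (auto simp: order_iso_def order_emb_def bij_betw_def partial_order_def R_def)
  have dR: "dcpo R" by (rule order_iso_dcpo[OF QR assms(2) R])
  have "order_iso (Gamma P) (Gamma R) ((`) j \<circ> h)"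
    by (rule order_iso_trans[OF h order_iso_Gamma[OF QR]])
  then obtain f where "dcpo_iso P R f" using assms(1) dR by (auto simp: gamma_unique_def)
  then have "order_iso P R f"
    using dcpo_iso_iff_order_iso dR assms(1) by (auto simp: gamma_unique_def)
  then show ?thesis
    using order_iso_imp_dcpo_iso[OF order_iso_trans[OF _ order_iso_inv[OF QR]]] by blast
qed

end

theory Submission
  imports Defs
begin

text \<open>
  Map \<open>P\<close> into a power of \<open>2\<close> by sending \<open>x\<close> to the family of Scott-closed
  sets that miss \<open>x\<close>, and let \<open>Q\<close> be the closure of the image under directed unions and under
  extensions of maps along members of \<open>E\<^sub>2\<close>. Every map \<open>A \<rightarrow> Q\<close> extends along every \<open>e : A \<rightarrow> B\<close>
  in \<open>E\<^sub>2\<close>, because the extension exists coordinatewise in the power of \<open>2\<close>, and the closure property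
  keeps its values in \<open>Q\<close>. On the other hand, two Scott-closed subsets of \<open>Q\<close> with the same trace
  on \<open>P\<close> coincide, by induction on the generation of \<open>Q\<close>, so \<open>\<Gamma>(P) \<cong> \<Gamma>(Q)\<close>. Uniqueness gives
  \<open>P \<cong> Q\<close>, and the extension property transfers to \<open>P\<close>. It suffices for membership in \<open>\<R>\<^sub>2\<close>,
  since principal ideals are Scott-closed and hence separate maps.
\<close>

subsection \<open>Scott-closed sets and Scott-continuous maps\<close>

lemma scott_continuous_funcset:
  "scott_continuous A B f \<Longrightarrow> x \<in> carrier A \<Longrightarrow> f x \<in> carrier B"
  by (auto simp: scott_continuous_def)

lemma scott_continuous_directed:
  assumes "dcpo A" "partial_order B" "scott_continuous A B f" "directed_in A D"
  shows "directed_in B (f ` D)"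
proof -
  have DA: "D \<subseteq> carrier A" and ne: "D \<noteq> {}"
    and dir: "\<And>x y. x \<in> D \<Longrightarrow> y \<in> D \<Longrightarrow> \<exists>z\<in>D. x \<sqsubseteq>\<^bsub>A\<^esub> z \<and> y \<sqsubseteq>\<^bsub>A\<^esub> z"
    using assms(4) by (simp_all add: directed_in_def)
  have le: "f x \<sqsubseteq>\<^bsub>B\<^esub> f y" if "x \<in> D" "y \<in> D" "x \<sqsubseteq>\<^bsub>A\<^esub> y" for x y
    by (rule scott_continuous_mono[OF assms(1-3)]) (use DA that in blast)+
  have "f ` D \<subseteq> carrier B" using DA scott_continuous_funcset[OF assms(3)] by blast
  moreover have "\<exists>z\<in>D. f x \<sqsubseteq>\<^bsub>B\<^esub> f z \<and> f y \<sqsubseteq>\<^bsub>B\<^esub> f z" if "x \<in> D" "y \<in> D" for x y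
    using dir[OF that] le that by meson
  ultimately show ?thesis using ne by (simp add: directed_in_def)
qed

lemma scott_closed_vimage:
  assumes "dcpo A" "partial_order B" "scott_continuous A B f" "scott_closed B G"
  shows "scott_closed A {x \<in> carrier A. f x \<in> G}"
  unfolding scott_closed_def
proof (intro conjI ballI allI impI)
  fix x y assume x: "x \<in> carrier A" and y: "y \<in> {x \<in> carrier A. f x \<in> G}"
    and xy: "x \<sqsubseteq>\<^bsub>A\<^esub> y"
  have "f x \<sqsubseteq>\<^bsub>B\<^esub> f y" by (rule scott_continuous_mono[OF assms(1-3) x _ xy]) (use y in simp)
  moreover have "f x \<in> carrier B" by (rule scott_continuous_funcset[OF assms(3) x])
  ultimately have "f x \<in> G" using y assms(4) unfolding scott_closed_def by blast
  then show "x \<in> {x \<in> carrier A. f x \<in> G}" using x by simp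
next
  fix D s assume *: "directed_in A D \<and> D \<subseteq> {x \<in> carrier A. f x \<in> G} \<and> is_lub A s D"
  then have "directed_in B (f ` D)" "f ` D \<subseteq> G" "is_lub B (f s) (f ` D)"
    using scott_continuous_directed[OF assms(1-3)] assms(3)
    unfolding scott_continuous_def by blast+
  then have "f s \<in> G" using assms(4) unfolding scott_closed_def by blast
  then show "s \<in> {x \<in> carrier A. f x \<in> G}" using * by (auto simp: least_def Upper_def)
qed auto

lemma scott_closed_Int:
  "scott_closed P F \<Longrightarrow> scott_closed P G \<Longrightarrow> scott_closed P (F \<inter> G)"
  unfolding scott_closed_def by blast

lemma scott_closed_carrier: "scott_closed P (carrier P)"
  unfolding scott_closed_def by (auto simp: least_def Upper_def)

lemma scott_continuous_compose:
  assumes "dcpo A" "partial_order B" "scott_continuous A B f" "scott_continuous B C g"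
  shows "scott_continuous A C (\<lambda>x. g (f x))"
  unfolding scott_continuous_def
proof (intro conjI allI impI)
  show "(\<lambda>x. g (f x)) \<in> carrier A \<rightarrow> carrier C"
    using assms(3,4) by (auto simp: scott_continuous_def)
next
  fix D s assume *: "directed_in A D \<and> is_lub A s D"
  then have "directed_in B (f ` D)" "is_lub B (f s) (f ` D)"
    using scott_continuous_directed[OF assms(1-3)] assms(3)
    unfolding scott_continuous_def by blast+
  then have "is_lub C (g (f s)) (g ` f ` D)"
    using assms(4) unfolding scott_continuous_def by blast
  then show "is_lub C (g (f s)) ((\<lambda>x. g (f x)) ` D)" by (simp only: image_image)
qed

lemma scott_continuous_cong:
  assumes "\<And>x. x \<in> carrier A \<Longrightarrow> f x = g x"
  shows "scott_continuous A B f \<longleftrightarrow> scott_continuous A B g"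
proof -
  have "is_lub B (f s) (f ` D) \<longleftrightarrow> is_lub B (g s) (g ` D)"
    if "directed_in A D" "is_lub A s D" for D s
  proof -
    have "f ` D = g ` D" using that assms by (intro image_cong) (auto simp: directed_in_def)
    moreover have "f s = g s" using that assms by (auto simp: least_def Upper_def)
    ultimately show ?thesis by simp
  qed
  moreover have "f \<in> carrier A \<rightarrow> carrier B \<longleftrightarrow> g \<in> carrier A \<rightarrow> carrier B"
    using assms by (simp add: Pi_iff)
  ultimately show ?thesis unfolding scott_continuous_def by blast
qed

lemma partial_order_fun_space:
  assumes "partial_order B"
  shows "partial_order (fun_space A B)"
proof -
  interpret partial_order B by fact
  show ?thesis
  proof
    fix f g assume fg: "f \<sqsubseteq>\<^bsub>fun_space A B\<^esub> g" "g \<sqsubseteq>\<^bsub>fun_space A B\<^esub> f"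
      "f \<in> carrier (fun_space A B)" "g \<in> carrier (fun_space A B)"
    have "f = g"
      by (rule PiE_ext[of f "carrier A" "\<lambda>_. carrier B"])
        (use fg in \<open>auto simp: fun_space_def intro!: le_antisym\<close>)
    then show "f .=\<^bsub>fun_space A B\<^esub> g" by (simp add: fun_space_def)
  next
    fix f g h assume "f \<sqsubseteq>\<^bsub>fun_space A B\<^esub> g" "g \<sqsubseteq>\<^bsub>fun_space A B\<^esub> h"
      "f \<in> carrier (fun_space A B)" "g \<in> carrier (fun_space A B)" "h \<in> carrier (fun_space A B)"
    then show "f \<sqsubseteq>\<^bsub>fun_space A B\<^esub> h"
      by (auto simp: fun_space_def) (meson PiE_mem le_trans)
  qed (auto simp: fun_space_def)
qed


subsection \<open>Members of \<open>E\<^sub>2\<close> in terms of Scott-closed sets\<close>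

lemma partial_order_two: "partial_order two"
  by unfold_locales (auto simp: two_def)

lemma scott_continuous_two_iff:
  assumes "dcpo A"
  shows "scott_continuous A two f \<longleftrightarrow> scott_closed A {x \<in> carrier A. \<not> f x}"
proof
  have "scott_closed two {False}"
    unfolding scott_closed_def
    by (auto simp: two_def least_def Upper_def)
  then show "scott_continuous A two f \<Longrightarrow> scott_closed A {x \<in> carrier A. \<not> f x}"
    using scott_closed_vimage[OF assms partial_order_two, of f "{False}"] by simp
next
  assume F: "scott_closed A {x \<in> carrier A. \<not> f x}"
  have "is_lub two (f s) (f ` D)" if D: "directed_in A D" "is_lub A s D" for D s
  proof -
    have s: "s \<in> carrier A" and le: "\<And>d. d \<in> D \<Longrightarrow> d \<sqsubseteq>\<^bsub>A\<^esub> s" and DA: "D \<subseteq> carrier A"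
      using D by (auto simp: least_def Upper_def directed_in_def)
    have "f s" if "d \<in> D" "f d" for d
      using F that le[OF that(1)] s DA unfolding scott_closed_def by blast
    moreover have "\<exists>d\<in>D. f d" if "f s"
      using F that D DA unfolding scott_closed_def by blast
    ultimately show ?thesis by (auto simp: two_def least_def Upper_def)
  qed
  then show "scott_continuous A two f" by (auto simp: scott_continuous_def two_def)
qed

lemma dcpo_iso_bij_betw: "dcpo_iso A B f \<Longrightarrow> bij_betw f (carrier A) (carrier B)"
  unfolding dcpo_iso_def scott_continuous_def
  by (elim conjE exE) (rule bij_betw_byWitness, auto)

text \<open>The point of \<open>fun_space A two\<close> whose zero set is \<open>F\<close>; the
  restriction makes it extensional, as elements of the function space must be.\<close>

definition non_member :: "('a, 'm) gorder_scheme \<Rightarrow> 'a set \<Rightarrow> 'a \<Rightarrow> bool"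
  where "non_member A F = restrict (\<lambda>x. x \<notin> F) (carrier A)"

lemma non_member_fun_space:
  assumes "dcpo A" "scott_closed A F"
  shows "non_member A F \<in> carrier (fun_space A two)"
proof -
  have "{x \<in> carrier A. \<not> non_member A F x} = F"
    using assms(2) by (auto simp: non_member_def scott_closed_def)
  then show ?thesis
    using assms(2)
    by (simp add: fun_space_def scott_continuous_two_iff[OF assms(1)])
      (simp add: non_member_def two_def)
qed

text \<open>Injectivity of \<open>precomp A e\<close> for \<open>two\<close>. Comparing
  \<open>G\<close> with \<open>G \<inter> G'\<close> instead of \<open>G'\<close> turns the
  inclusion into an equation: the two characteristic maps agree after composition with
  \<open>e\<close>, hence are equal.\<close>

lemma in_E2_vimage_subset:
  assumes e: "in_E2 A B e" and G: "scott_closed B G" "scott_closed B G'"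
    and sub: "\<And>a. a \<in> carrier A \<Longrightarrow> e a \<in> G \<Longrightarrow> e a \<in> G'"
  shows "G \<subseteq> G'"
proof -
  have A: "dcpo A" and B: "dcpo B" and ec: "scott_continuous A B e"
    and bij: "bij_betw (precomp A e) (carrier (fun_space B two)) (carrier (fun_space A two))"
    using e by (auto simp: in_E2_def dest: dcpo_iso_bij_betw)
  have "precomp A e (non_member B G) = precomp A e (non_member B (G \<inter> G'))"
    using sub scott_continuous_funcset[OF ec]
    by (auto simp: precomp_def compose_def non_member_def restrict_def)
  then have "non_member B G = non_member B (G \<inter> G')"
    using bij non_member_fun_space[OF B G(1)] non_member_fun_space[OF B scott_closed_Int[OF G]]
    by (auto simp: bij_betw_def dest: inj_onD)
  then have "b \<notin> G \<longleftrightarrow> b \<notin> G \<inter> G'" if "b \<in> carrier B" for b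
    using that unfolding non_member_def by (metis restrict_apply')
  moreover have "G \<subseteq> carrier B" using G(1) by (simp add: scott_closed_def)
  ultimately show ?thesis by blast
qed

text \<open>Surjectivity of \<open>precomp A e\<close> for \<open>two\<close>: \<open>G\<close> is
  the zero set of a preimage of \<open>non_member A F\<close>.\<close>

lemma in_E2_vimage_surj:
  assumes e: "in_E2 A B e" and F: "scott_closed A F"
  obtains G where "scott_closed B G" "\<And>a. a \<in> carrier A \<Longrightarrow> e a \<in> G \<longleftrightarrow> a \<in> F"
proof -
  have A: "dcpo A" and B: "dcpo B" and ec: "scott_continuous A B e"
    and bij: "bij_betw (precomp A e) (carrier (fun_space B two)) (carrier (fun_space A two))"
    using e by (auto simp: in_E2_def dest: dcpo_iso_bij_betw)
  obtain u where u: "u \<in> carrier (fun_space B two)" "precomp A e u = non_member A F"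
    using bij non_member_fun_space[OF A F] unfolding bij_betw_def by (metis imageE)
  show thesis
  proof
    show "scott_closed B {b \<in> carrier B. \<not> u b}"
      using u(1) scott_continuous_two_iff[OF B] by (simp add: fun_space_def)
    show "e a \<in> {b \<in> carrier B. \<not> u b} \<longleftrightarrow> a \<in> F" if "a \<in> carrier A" for a
      using fun_cong[OF u(2), of a] that scott_continuous_funcset[OF ec that]
      by (auto simp: precomp_def compose_def non_member_def)
  qed
qed


subsection \<open>An extension criterion for membership in \<open>\<R>\<^sub>2\<close>\<close>

text \<open>Take the principal ideal of \<open>h b\<close> and its preimages under \<open>h\<close>
  and \<open>g\<close>. By \<open>le\<close> the first is contained in the second on the image of
  \<open>e\<close>, hence everywhere, and \<open>b\<close> lies in the first.\<close>

lemma in_E2_precomp_le: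
  assumes e: "in_E2 A B e" and C: "dcpo C"
    and g: "scott_continuous B C g" and h: "scott_continuous B C h"
    and le: "\<And>a. a \<in> carrier A \<Longrightarrow> g (e a) \<sqsubseteq>\<^bsub>C\<^esub> h (e a)" and b: "b \<in> carrier B"
  shows "g b \<sqsubseteq>\<^bsub>C\<^esub> h b"
proof -
  interpret C: dcpo C by fact
  have B: "dcpo B" and ec: "scott_continuous A B e" using e by (auto simp: in_E2_def)
  let ?I = "{c \<in> carrier C. c \<sqsubseteq>\<^bsub>C\<^esub> h b}"
  have I: "scott_closed C ?I"
    by (rule scott_closed_down[OF C scott_continuous_funcset[OF h b]])
  have "{x \<in> carrier B. h x \<in> ?I} \<subseteq> {x \<in> carrier B. g x \<in> ?I}"
  proof (rule in_E2_vimage_subset[OF e])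
    fix a assume a: "a \<in> carrier A" "e a \<in> {x \<in> carrier B. h x \<in> ?I}"
    then show "e a \<in> {x \<in> carrier B. g x \<in> ?I}"
      using C.le_trans[OF le[OF a(1)]] scott_continuous_funcset[OF g]
        scott_continuous_funcset[OF h] b by auto
  qed (rule scott_closed_vimage[OF B C.partial_order_axioms _ I], fact)+
  then show ?thesis using b scott_continuous_funcset[OF h b] by auto
qed

text \<open>The hypothesis \<open>ext\<close> supplies surjectivity of \<open>precomp A e\<close>;
  \<open>in_E2_precomp_le\<close> makes it an order embedding and so injective.\<close>

lemma in_R2I:
  fixes C :: "'c gorder"
  assumes C: "dcpo C"
    and ext: "\<And>(A :: 'a gorder) (B :: 'b gorder) e f.
      in_E2 A B e \<Longrightarrow> scott_continuous A C f \<Longrightarrow>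
      \<exists>g. scott_continuous B C g \<and> (\<forall>a\<in>carrier A. g (e a) = f a)"
  shows "in_R2 TYPE('a) TYPE('b) C"
  unfolding in_R2_def
proof (intro conjI allI impI)
  fix A :: "'a gorder" and B :: "'b gorder" and e
  assume e: "in_E2 A B e"
  interpret C: dcpo C by fact
  have A: "dcpo A" and B: "dcpo B" and ec: "scott_continuous A B e"
    using e by (auto simp: in_E2_def)
  interpret B: dcpo B by fact
  let ?BC = "fun_space B C" and ?AC = "fun_space A C" and ?p = "precomp A e"
  interpret BC: partial_order ?BC by (rule partial_order_fun_space[OF C.partial_order_axioms])
  interpret AC: partial_order ?AC by (rule partial_order_fun_space[OF C.partial_order_axioms])
  have eB: "e a \<in> carrier B" if "a \<in> carrier A" for a
    using scott_continuous_funcset[OF ec that] .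
  have p: "?p g \<in> carrier ?AC" if "g \<in> carrier ?BC" for g
  proof -
    have "scott_continuous A C (\<lambda>x. g (e x))"
      by (rule scott_continuous_compose[OF A B.partial_order_axioms ec])
        (use that in \<open>simp add: fun_space_def\<close>)
    then have "scott_continuous A C (?p g)"
      by (subst scott_continuous_cong[where g = "\<lambda>x. g (e x)"])
        (auto simp: precomp_def compose_def)
    then show ?thesis
      by (auto simp: fun_space_def precomp_def compose_def dest: scott_continuous_funcset)
  qed
  have le: "?p g \<sqsubseteq>\<^bsub>?AC\<^esub> ?p h \<longleftrightarrow> g \<sqsubseteq>\<^bsub>?BC\<^esub> h"
    if "g \<in> carrier ?BC" "h \<in> carrier ?BC" for g h
  proof -
    have "?p g \<sqsubseteq>\<^bsub>?AC\<^esub> ?p h \<longleftrightarrow> (\<forall>a\<in>carrier A. g (e a) \<sqsubseteq>\<^bsub>C\<^esub> h (e a))"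
      by (simp add: fun_space_def precomp_def compose_def)
    also have "\<dots> \<longleftrightarrow> (\<forall>b\<in>carrier B. g b \<sqsubseteq>\<^bsub>C\<^esub> h b)"
      using in_E2_precomp_le[OF e C] that eB by (auto simp: fun_space_def)
    finally show ?thesis by (simp add: fun_space_def)
  qed
  have "inj_on ?p (carrier ?BC)"
    by (rule inj_onI) (metis BC.le_antisym BC.le_refl le)
  moreover have "f \<in> ?p ` carrier ?BC" if f: "f \<in> carrier ?AC" for f
  proof -
    obtain g where g: "scott_continuous B C g" "\<And>a. a \<in> carrier A \<Longrightarrow> g (e a) = f a"
      using ext[OF e, of f] f by (auto simp: fun_space_def)
    \<comment> \<open>The restriction makes \<open>g\<close> extensional and leaves its composite
      with \<open>e\<close> unchanged, since \<open>e\<close> maps into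
      \<open>carrier B\<close>.\<close>
    let ?g = "restrict g (carrier B)"
    have "scott_continuous B C ?g" using g(1) by (subst scott_continuous_cong[where g = g]) auto
    then have "?g \<in> carrier ?BC"
      using g(1) by (auto simp: fun_space_def dest: scott_continuous_funcset)
    moreover have "f = ?p ?g"
      using f g(2) eB by (auto simp: fun_space_def precomp_def compose_def PiE_def extensional_def)
    ultimately show ?thesis by blast
  qed
  ultimately have "bij_betw ?p (carrier ?BC) (carrier ?AC)"
    using p by (auto simp: bij_betw_def)
  then have "order_iso ?BC ?AC ?p"
    using le BC.weak_partial_order_axioms AC.weak_partial_order_axioms
    by (simp add: order_iso_def order_emb_def)
  then show "dcpo_iso ?BC ?AC ?p" by (rule order_iso_imp_dcpo_iso)
qed fact


subsection \<open>Subsets of a power of \<open>2\<close>\<close>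

abbreviation inclusion_order :: "'i set set \<Rightarrow> 'i set gorder"
  where "inclusion_order S \<equiv> \<lparr>carrier = S, eq = (=), le = (\<subseteq>)\<rparr>"

text \<open>The type arguments are those of the test maps in \<open>in_R2\<close>. The second
  premise of \<open>extension\<close> says that \<open>g\<close> is Scott-continuous as a map into the power of \<open>2\<close>.\<close>

inductive_set E2_hull :: "'a itself \<Rightarrow> 'b itself \<Rightarrow> 'i set set \<Rightarrow> 'i set set"
  for TA :: "'a itself" and TB :: "'b itself" and X :: "'i set set"
  where
    base: "x \<in> X \<Longrightarrow> x \<in> E2_hull TA TB X"
  | directed_Union: "(\<And>d. d \<in> D \<Longrightarrow> d \<in> E2_hull TA TB X) \<Longrightarrow>
      directed_in (inclusion_order UNIV) D \<Longrightarrow> \<Union>D \<in> E2_hull TA TB X"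
  | extension: "in_E2 (A :: 'a gorder) (B :: 'b gorder) e \<Longrightarrow>
      (\<And>i. scott_closed B {b \<in> carrier B. i \<notin> g b}) \<Longrightarrow>
      (\<And>a. a \<in> carrier A \<Longrightarrow> g (e a) \<in> E2_hull TA TB X) \<Longrightarrow>
      b \<in> carrier B \<Longrightarrow> g b \<in> E2_hull TA TB X"

lemma directed_in_inclusion_order:
  "directed_in (inclusion_order S) D \<longleftrightarrow> D \<subseteq> S \<and> directed_in (inclusion_order UNIV) D"
  by (auto simp: directed_in_def)

lemma is_lub_inclusion_order_Union:
  "D \<subseteq> S \<Longrightarrow> \<Union>D \<in> S \<Longrightarrow> is_lub (inclusion_order S) (\<Union>D) D"
  by (auto simp: least_def Upper_def)

lemma is_lub_inclusion_order_iff: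
  assumes "D \<subseteq> S" "\<Union>D \<in> S"
  shows "is_lub (inclusion_order S) s D \<longleftrightarrow> s = \<Union>D"
proof -
  interpret partial_order "inclusion_order S" by (rule partial_order_inclusion)
  show ?thesis
    using is_lub_inclusion_order_Union[OF assms] least_unique by auto
qed

lemma E2_hull_Union:
  "directed_in (inclusion_order (E2_hull TA TB X)) D \<Longrightarrow> \<Union>D \<in> E2_hull TA TB X"
  using directed_in_inclusion_order[of "E2_hull TA TB X" D]
  by (auto intro: E2_hull.directed_Union)

lemma dcpo_E2_hull: "dcpo (inclusion_order (E2_hull TA TB X))"
proof -
  interpret partial_order "inclusion_order (E2_hull TA TB X)" by (rule partial_order_inclusion)
  show ?thesis
  proof
    fix D assume D: "directed_in (inclusion_order (E2_hull TA TB X)) D"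
    then show "\<exists>s. is_lub (inclusion_order (E2_hull TA TB X)) s D"
      using is_lub_inclusion_order_Union[OF _ E2_hull_Union[OF D]]
      by (auto simp: directed_in_def)
  qed
qed

lemma scott_continuous_inclusion_orderI:
  assumes gS: "g \<in> carrier B \<rightarrow> S"
    and closed: "\<And>i. scott_closed B {b \<in> carrier B. i \<notin> g b}"
  shows "scott_continuous B (inclusion_order S) g"
  unfolding scott_continuous_def
proof (intro conjI allI impI)
  fix D s assume *: "directed_in B D \<and> is_lub B s D"
  have s: "s \<in> carrier B" and le: "\<And>d. d \<in> D \<Longrightarrow> d \<sqsubseteq>\<^bsub>B\<^esub> s" and DB: "D \<subseteq> carrier B"
    using * by (auto simp: least_def Upper_def directed_in_def)
  have "g d \<subseteq> g s" if "d \<in> D" for d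
    using closed le[OF that] DB that s unfolding scott_closed_def by blast
  moreover have "\<exists>d\<in>D. i \<in> g d" if "i \<in> g s" for i
    using closed[of i] * that DB unfolding scott_closed_def by blast
  ultimately have U: "\<Union>(g ` D) = g s" by blast
  have "g ` D \<subseteq> S" "g s \<in> S" using gS s DB by auto
  then show "is_lub (inclusion_order S) (g s) (g ` D)"
    using is_lub_inclusion_order_iff[of "g ` D" S "g s"] by (simp only: U)
qed (use gS in simp)

text \<open>Continuity of the \<open>i\<close>-th coordinate projection: directed suprema in the
  hull are unions.\<close>

lemma scott_closed_not_mem:
  "scott_closed (inclusion_order (E2_hull TA TB X)) {q \<in> E2_hull TA TB X. i \<notin> q}"
  unfolding scott_closed_def
proof (intro conjI ballI allI impI)
  let ?H = "inclusion_order (E2_hull TA TB X)"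
  fix D s assume *: "directed_in ?H D \<and> D \<subseteq> {q \<in> E2_hull TA TB X. i \<notin> q} \<and> is_lub ?H s D"
  then have "D \<subseteq> E2_hull TA TB X" "\<Union>D \<in> E2_hull TA TB X"
    using E2_hull_Union[of TA TB X D] by (auto simp: directed_in_def)
  then have "s = \<Union>D" using * is_lub_inclusion_order_iff by blast
  then show "s \<in> {q \<in> E2_hull TA TB X. i \<notin> q}"
    using * E2_hull_Union by blast
qed auto

lemma E2_hull_extension:
  fixes A :: "'a gorder" and B :: "'b gorder" and X :: "'i set set"
  defines "H \<equiv> inclusion_order (E2_hull TYPE('a) TYPE('b) X)"
  assumes e: "in_E2 A B e" and f: "scott_continuous A H f"
  shows "\<exists>g. scott_continuous B H g \<and> (\<forall>a\<in>carrier A. g (e a) = f a)"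
proof -
  have A: "dcpo A" and ec: "scott_continuous A B e" using e by (auto simp: in_E2_def)
  have fH: "f a \<in> E2_hull TYPE('a) TYPE('b) X" if "a \<in> carrier A" for a
    using scott_continuous_funcset[OF f that] by (simp add: H_def)
  \<comment> \<open>Coordinate \<open>i\<close> of \<open>f\<close> is a map into \<open>2\<close>,
    so it extends along \<open>e\<close>; \<open>G\<close> is the zero set of the extension.\<close>
  have "\<exists>G. scott_closed B G \<and> (\<forall>a\<in>carrier A. e a \<in> G \<longleftrightarrow> i \<notin> f a)" for i
  proof -
    have "scott_closed A {a \<in> carrier A. f a \<in> {q \<in> E2_hull TYPE('a) TYPE('b) X. i \<notin> q}}"
      by (rule scott_closed_vimage[OF A _ f])
        (simp_all add: H_def partial_order_inclusion scott_closed_not_mem)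
    then show ?thesis
      by (rule in_E2_vimage_surj[OF e]) (use fH in auto)
  qed
  then obtain G where G: "\<And>i. scott_closed B (G i)"
    "\<And>i a. a \<in> carrier A \<Longrightarrow> e a \<in> G i \<longleftrightarrow> i \<notin> f a"
    by metis
  \<comment> \<open>The extended coordinates are reassembled into one map into the power of
    \<open>2\<close>.\<close>
  define g where "g b = {i. b \<notin> G i}" for b
  have closed: "scott_closed B {b \<in> carrier B. i \<notin> g b}" for i
  proof -
    have "{b \<in> carrier B. i \<notin> g b} = G i" using G(1)[of i] by (auto simp: g_def scott_closed_def)
    then show ?thesis using G(1) by simp
  qed
  have ge: "g (e a) = f a" if "a \<in> carrier A" for a using G(2)[OF that] by (auto simp: g_def)
  have "g b \<in> E2_hull TYPE('a) TYPE('b) X" if "b \<in> carrier B" for b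
    using E2_hull.extension[OF e closed _ that] ge fH by simp
  then have "scott_continuous B H g"
    unfolding H_def by (intro scott_continuous_inclusion_orderI closed) auto
  then show ?thesis using ge by blast
qed

text \<open>Induction on the generation of the hull. At a directed union in \<open>G\<close>, all
  members lie in the lower set \<open>G\<close>, hence in \<open>G'\<close>, which is closed under
  directed suprema. At an extension step, the preimages of \<open>G\<close> and \<open>G'\<close>
  under \<open>g\<close> are compared on the image of \<open>e\<close>.\<close>

lemma E2_hull_scott_closed_subset:
  fixes TA :: "'a itself" and TB :: "'b itself" and X :: "'i set set"
  defines "H \<equiv> inclusion_order (E2_hull TA TB X)"
  assumes G: "scott_closed H G" and G': "scott_closed H G'" and sub: "X \<inter> G \<subseteq> G'"
  shows "G \<subseteq> G'"
proof -
  have H: "dcpo H" "partial_order H"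
    by (simp_all add: H_def dcpo_E2_hull partial_order_inclusion)
  have "q \<in> G \<longrightarrow> q \<in> G'" if "q \<in> E2_hull TA TB X" for q
    using that
  proof induction
    case (base x)
    then show ?case using sub by blast
  next
    case (directed_Union D)
    then have D: "directed_in H D"
      unfolding H_def by (subst directed_in_inclusion_order) auto
    then have lub: "is_lub H (\<Union>D) D"
      unfolding H_def by (intro is_lub_inclusion_order_Union E2_hull_Union)
        (auto simp: directed_in_def)
    have "D \<subseteq> G" if "\<Union>D \<in> G"
    proof
      fix d assume "d \<in> D"
      then have "d \<in> carrier H" "d \<sqsubseteq>\<^bsub>H\<^esub> \<Union>D" using directed_Union(1) by (auto simp: H_def)
      then show "d \<in> G" using G that unfolding scott_closed_def by blast
    qed
    then show ?case
      using directed_Union.IH D lub G' unfolding scott_closed_def by blast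
  next
    case (extension A B e g b)
    have B: "dcpo B" using extension(1) by (simp add: in_E2_def)
    \<comment> \<open>The rule applies at every point of \<open>B\<close>, so \<open>g\<close> is a
      map into \<open>H\<close> and has Scott-closed preimages.\<close>
    have gH: "g b \<in> E2_hull TA TB X" if "b \<in> carrier B" for b
      using E2_hull.extension[OF extension(1,2) _ that] extension(3) by blast
    have g: "scott_continuous B H g"
      unfolding H_def using gH by (intro scott_continuous_inclusion_orderI extension(2)) auto
    have "{b \<in> carrier B. g b \<in> G} \<subseteq> {b \<in> carrier B. g b \<in> G'}"
      by (rule in_E2_vimage_subset[OF extension(1) scott_closed_vimage[OF B H(2) g G]
            scott_closed_vimage[OF B H(2) g G']])
        (use extension.IH in blast)
    then show ?case using extension(4) by blast
  qed
  then show ?thesis using G by (auto simp: scott_closed_def H_def)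
qed


subsection \<open>A dcpo with the same Scott-closed sets\<close>

text \<open>Coordinate \<open>F\<close> is the characteristic map of the open complement of
  \<open>F\<close>. Complements make the map monotone for inclusion: a larger point misses more
  Scott-closed sets.\<close>

definition missing :: "('p, 'm) gorder_scheme \<Rightarrow> 'p \<Rightarrow> 'p set set"
  where "missing P x = {F. scott_closed P F \<and> x \<notin> F}"

text \<open>The inverse sends a Scott-closed set of \<open>H\<close> to its trace on
  \<open>P\<close>, that is, its preimage under \<open>missing P\<close>: the trace of the image of
  \<open>F\<close> is \<open>F\<close>, and traces determine Scott-closed subsets of the
  hull.\<close>

lemma order_iso_Gamma_E2_hull:
  fixes P :: "'p gorder" and TA :: "'a itself" and TB :: "'b itself"
  assumes P: "dcpo P"
  defines "H \<equiv> inclusion_order (E2_hull TA TB (missing P ` carrier P))"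
  shows "order_iso (Gamma P) (Gamma H) (\<lambda>F. {q \<in> carrier H. F \<notin> q})"
proof -
  let ?h = "\<lambda>F. {q \<in> carrier H. F \<notin> q}"
  have H: "partial_order H" by (simp add: H_def partial_order_inclusion)
  have mH: "missing P x \<in> carrier H" if "x \<in> carrier P" for x
    using that by (simp add: H_def E2_hull.base)
  have h: "scott_closed H (?h F)" for F
    unfolding H_def using scott_closed_not_mem by simp
  have mh: "missing P x \<in> ?h F \<longleftrightarrow> x \<in> F" if "scott_closed P F" "x \<in> carrier P" for x F
    using that mH by (auto simp: missing_def)
  have m: "scott_continuous P H (missing P)"
    unfolding H_def
  proof (rule scott_continuous_inclusion_orderI)
    show "scott_closed P {x \<in> carrier P. F \<notin> missing P x}" for F
    \<comment> \<open>An index that is not Scott-closed never belongs to \<open>missing P x\<close>,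
      so its zero set is all of \<open>carrier P\<close>.\<close>
    proof (cases "scott_closed P F")
      case True
      then have "{x \<in> carrier P. F \<notin> missing P x} = F"
        by (auto simp: missing_def scott_closed_def)
      then show ?thesis using True by simp
    qed (simp add: missing_def scott_closed_carrier)
  qed (simp add: E2_hull.base)
  have sub: "G \<subseteq> G'" if "scott_closed H G" "scott_closed H G'"
    "\<And>x. x \<in> carrier P \<Longrightarrow> missing P x \<in> G \<Longrightarrow> missing P x \<in> G'" for G G'
    using E2_hull_scott_closed_subset[of TA TB "missing P ` carrier P" G G'] that
    by (auto simp: H_def)
  have le: "?h F \<subseteq> ?h F' \<longleftrightarrow> F \<subseteq> F'" if F: "scott_closed P F" "scott_closed P F'" for F F'
  proof
    assume "?h F \<subseteq> ?h F'"
    then have "x \<in> F'" if "x \<in> F" for x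
      using F that mh[OF F(1), of x] mh[OF F(2), of x] unfolding scott_closed_def by blast
    then show "F \<subseteq> F'" by blast
  next
    assume "F \<subseteq> F'"
    then show "?h F \<subseteq> ?h F'" by (intro sub h) (use mh F in blast)
  qed
  have "inj_on ?h {F. scott_closed P F}"
    by (rule inj_onI) (metis (no_types, lifting) le mem_Collect_eq order_antisym order_refl)
  moreover have "?h ` {F. scott_closed P F} = {G. scott_closed H G}"
  proof (intro equalityI subsetI)
    fix G assume "G \<in> {G. scott_closed H G}"
    then have G: "scott_closed H G" by simp
    define F where "F = {x \<in> carrier P. missing P x \<in> G}"
    have F: "scott_closed P F" unfolding F_def by (rule scott_closed_vimage[OF P H m G])
    have "?h F = G"
      by (intro equalityI sub h G) (use mh[OF F] in \<open>auto simp: F_def\<close>)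
    then show "G \<in> ?h ` {F. scott_closed P F}" using F by blast
  qed (use h in auto)
  ultimately have "bij_betw ?h (carrier (Gamma P)) (carrier (Gamma H))"
    by (simp add: bij_betw_def Gamma_def)
  moreover have "?h F \<sqsubseteq>\<^bsub>Gamma H\<^esub> ?h F' \<longleftrightarrow> F \<sqsubseteq>\<^bsub>Gamma P\<^esub> F'"
    if "F \<in> carrier (Gamma P)" "F' \<in> carrier (Gamma P)" for F F'
    using le that by (simp add: Gamma_def)
  ultimately show ?thesis
    using partial_order_Gamma[of P] partial_order_Gamma[of H]
    by (simp add: order_iso_def order_emb_def partial_order_def)
qed

theorem proposition6p13:
  fixes P :: "'p gorder"
  assumes "gamma_unique P"
  shows "in_R2 TYPE('a) TYPE('b) P"
proof -
  have P: "dcpo P" using assms by (simp add: gamma_unique_def)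
  define H where "H = inclusion_order (E2_hull TYPE('a) TYPE('b) (missing P ` carrier P))"
  have H: "dcpo H" unfolding H_def by (rule dcpo_E2_hull)
  \<comment> \<open>The elements of \<open>H\<close> have type \<open>'p set set\<close>, whereas
    \<open>gamma_unique\<close> quantifies over dcpos on \<open>'p set\<close>;
    \<open>gamma_uniqueD\<close> bridges the gap.\<close>
  obtain k where "dcpo_iso P H k"
    using gamma_uniqueD[OF assms H] order_iso_Gamma_E2_hull[OF P] unfolding H_def by blast
  then obtain l where k: "scott_continuous P H k" and l: "scott_continuous H P l"
    and lk: "\<And>x. x \<in> carrier P \<Longrightarrow> l (k x) = x"
    by (auto simp: dcpo_iso_def)
  interpret P: dcpo P by fact
  interpret H: dcpo H by fact
  show ?thesis
  proof (rule in_R2I[OF P])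
    fix A :: "'a gorder" and B :: "'b gorder" and e f
    assume e: "in_E2 A B e" and f: "scott_continuous A P f"
    have A: "dcpo A" and B: "dcpo B" using e by (auto simp: in_E2_def)
    \<comment> \<open>The map \<open>f\<close> is carried to \<open>H\<close> by \<open>k\<close>,
      extended there, and the extension is brought back by \<open>l\<close>.\<close>
    have "scott_continuous A H (\<lambda>a. k (f a))"
      by (rule scott_continuous_compose[OF A P.partial_order_axioms f k])
    then obtain g where g: "scott_continuous B H g" "\<forall>a\<in>carrier A. g (e a) = k (f a)"
      using E2_hull_extension[OF e] unfolding H_def by blast
    have "scott_continuous B P (\<lambda>b. l (g b))"
      by (rule scott_continuous_compose[OF B H.partial_order_axioms g(1) l])
    then show "\<exists>g. scott_continuous B P g \<and> (\<forall>a\<in>carrier A. g (e a) = f a)"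
      using g(2) lk scott_continuous_funcset[OF f] by (auto intro!: exI[of _ "\<lambda>b. l (g b)"])
  qed
qed

end
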